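(* Let $n$ and $s$ be integers for which $t=(n-3s+1)/2$ is a positive integer and $n\le 7s/2-1$, and let $T\subseteq[0,2t-1]$ be a set of integers. Then $T$ is $t$-special if and only if $S_T$ is a complete sum-free subset of $\mathbb{Z}_n$ of size $s$.
   Context: $\mathbb{Z}_n$ is the cyclic group of integers modulo $n$. For subsets $A,B$ of an abelian additive group $G$, $A+B=\{x+y \mid x\in A, y\in B\}$, $-A=\{-x \mid x\in A\}$, and $\pm A=A\cup(-A)$. A set $S\subseteq G$ is complete if every $z\in G\setminus S$ satisfies $z\in S+S$, and sum-free if $S\cap(S+S)=\emptyset$. For integers $a\le b$, $[a,b]=\{z\in\mathbb{Z} \mid a\le z\le b\}$; the same notation is used for the subset of $\mathbb{Z}_n$ represented by these integers. Definition of $S_T$: let $n$ and $s$ be integers for which $t=(n-3s+1)/2$ is a positive integer and $n\le 4s-3$ (this last inequality follows from the hypotheses of the claim). For a set of integers $T\subseteq[0,2t-1]$, $S_T\subseteq\mathbb{Z}_n$ is the set $S_T=[n-2s+1,2s-1]\cup\pm(s+T)$ (taken modulo $n$), where $s+T=\{s+x \mid x\in T\}$. For an integer $t\ge 1$, a set of integers $T\subseteq[0,2t-1]$ is called $t$-special if (i) $|T|=t$, (ii) $2t-1\notin T+T+T$, and (iii) $[0,2t-1+\min(T)]\setminus(2t-1-T)\subseteq T+T$, where $2t-1-T=\{2t-1-x \mid x\in T\}$, $\min(T)$ is the smallest integer in $T$, and all additions are over the integers. *)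

theory Defs
  imports
    Complex_Main
    "HOL-Algebra.Elementary_Groups"
    "HOL-Library.Set_Algebras"
begin

text \<open>
  The group operation of \<^term>\<open>integer_mod_group n\<close> is addition modulo \<open>n\<close>, so the sumset
  \<open>A + B\<close> in that group is the product set \<open>A <#> B\<close> of HOL-Algebra. For sets of integers, the
  sumset is \<open>+\<close> from \<^theory>\<open>HOL-Library.Set_Algebras\<close>.
\<close>

definition complete_in :: "('a, 'b) monoid_scheme \<Rightarrow> 'a set \<Rightarrow> bool"
  where "complete_in G S \<longleftrightarrow> (\<forall>z \<in> carrier G - S. z \<in> S <#>\<^bsub>G\<^esub> S)"

definition sum_free_in :: "('a, 'b) monoid_scheme \<Rightarrow> 'a set \<Rightarrow> bool"
  where "sum_free_in G S \<longleftrightarrow> S \<inter> (S <#>\<^bsub>G\<^esub> S) = {}"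

definition plus_minus :: "'a::ab_group_add set \<Rightarrow> 'a set"
  where "plus_minus A = A \<union> uminus ` A"

text \<open>Elements of \<^term>\<open>integer_mod_group n\<close> are the canonical representatives in \<open>{0..<n}\<close>.\<close>

definition residues_mod :: "int \<Rightarrow> int set \<Rightarrow> int set"
  where "residues_mod n A = (\<lambda>z. z mod n) ` A"

definition S_of :: "int \<Rightarrow> int \<Rightarrow> int set \<Rightarrow> int set"
  where "S_of n s T =
    residues_mod n ({n - 2*s + 1 .. 2*s - 1} \<union> plus_minus ((\<lambda>x. s + x) ` T))"

definition special :: "int \<Rightarrow> int set \<Rightarrow> bool"
  where "special t T \<longleftrightarrow>
    t \<ge> 1 \<and> T \<subseteq> {0 .. 2*t - 1} \<and>
    int (card T) = t \<and>
    2*t - 1 \<notin> T + T + T \<and>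
    {0 .. 2*t - 1 + Min T} - (\<lambda>x. 2*t - 1 - x) ` T \<subseteq> T + T"

end

theory Submission
  imports Defs
begin

text \<open>
  The hypotheses amount to \<open>n = 3 * s + 2 * t - 1\<close> and \<open>4 * t \<le> s\<close>. In terms of
  representatives in \<open>{0..<n}\<close>, the set \<open>S\<close> consists of three blocks: a copy of \<open>T\<close> inside
  \<open>{s..s + 2 * t - 1}\<close>, the full middle interval \<open>{s + 2 * t..2 * s - 1}\<close> with \<open>s - 2 * t\<close>
  elements, and the mirror image of the first block. The blocks are disjoint, so \<open>S\<close> has
  \<open>s\<close> elements exactly when \<open>T\<close> has \<open>t\<close> elements.

  As \<open>S = -S\<close>, a violation of sum-freeness is a triple in \<open>S\<close> with sum \<open>0\<close> modulo \<open>n\<close>. For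
  representatives the sum is then \<open>n\<close> or \<open>2 * n\<close>, and the reflection \<open>x \<mapsto> n - x\<close> exchanges
  the two. A sum equal to \<open>n = 3 * s + (2 * t - 1)\<close> forces all three summands into the first
  block, because every element of \<open>S\<close> is at least \<open>s\<close>. So sum-freeness says precisely that
  \<open>2 * t - 1\<close> is not a sum of three elements of \<open>T\<close>.

  For completeness put \<open>m = Min T\<close>. By symmetry only the part of \<open>{0..<n}\<close> up to \<open>2 * s - 1\<close>
  matters. Sums that use the middle interval cover
  \<open>{0..s - 1 - m}\<close>, and the middle interval itself lies in \<open>S\<close>. The residues \<open>z\<close> left over are
  those in \<open>{s - m..s + 2 * t - 1}\<close>; no sum that involves the middle interval reaches them, and
  the only sums that do are sums of two elements of the third block. Such a sum
  represents \<open>z\<close> exactly when \<open>s + 2 * t - 1 - z \<in> T + T\<close>. The substitution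
  \<open>w = s + 2 * t - 1 - z\<close> turns completeness into the last condition on a special set.
\<close>

section \<open>Sumsets modulo n on representatives\<close>

lemma mem_sumset_mod_iff:
  fixes n z :: int
  assumes "0 < n" and "A \<subseteq> {0..<n}" and "0 \<le> z" and "z < n"
  shows "z \<in> A <#>\<^bsub>integer_mod_group (nat n)\<^esub> A \<longleftrightarrow>
    (\<exists>x\<in>A. \<exists>y\<in>A. x + y = z \<or> x + y = z + n)"
proof -
  have "z = (x + y) mod n \<longleftrightarrow> x + y = z \<or> x + y = z + n" if "x \<in> A" "y \<in> A" for x y
  proof -
    have b: "0 \<le> x" "x < n" "0 \<le> y" "y < n"
      using that assms by auto
    show ?thesis
    proof (cases "x + y < n")
      case True
      then show ?thesis using b assms by auto
    next
      case False
      then have "(x + y) mod n = x + y - n"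
        using b by (metis add_strict_mono diff_add_cancel diff_ge_0_iff_ge diff_less_eq linorder_not_less
            minus_mod_self2 mod_pos_pos_trivial)
      then show ?thesis using b assms False by auto
    qed
  qed
  then show ?thesis
    using assms unfolding set_mult_def by (auto simp: integer_mod_group_def)
qed

section \<open>The blocks of S\<close>

locale block_parameters =
  fixes n s t :: int and T :: "int set"
  assumes n_eq: "n = 3 * s + 2 * t - 1"
    and t_pos: "0 < t"
    and four_t_le: "4 * t \<le> s"
    and T_subset: "T \<subseteq> {0..2 * t - 1}"
begin

abbreviation "S \<equiv> S_of n s T"

lemma T_bounds: "x \<in> T \<Longrightarrow> 0 \<le> x \<and> x \<le> 2 * t - 1"
  using T_subset by auto

lemma finite_T: "finite T"
  using T_subset finite_subset by blast

lemma S_eq_blocks: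
  "S = {s + 2 * t..2 * s - 1} \<union> (\<lambda>x. s + x) ` T \<union> (\<lambda>x. n - s - x) ` T"
proof -
  have "(\<lambda>z. z mod n) ` {n - 2*s + 1..2*s - 1} = {s + 2 * t..2 * s - 1}"
  proof -
    have "(\<lambda>z. z mod n) ` {n - 2*s + 1..2*s - 1} = id ` {n - 2*s + 1..2*s - 1}"
      using n_eq t_pos four_t_le by (intro image_cong) auto
    moreover have "n - 2*s + 1 = s + 2 * t" using n_eq by simp
    ultimately show ?thesis by (simp only: image_id id_apply)
  qed
  moreover have "(\<lambda>x. (s + x) mod n) ` T = (\<lambda>x. s + x) ` T"
    using n_eq t_pos four_t_le by (intro image_cong) (auto dest: T_bounds)
  moreover have "(\<lambda>x. (- s - x) mod n) ` T = (\<lambda>x. n - s - x) ` T"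
  proof (intro image_cong refl)
    fix x assume "x \<in> T"
    then have "(n - s - x) mod n = n - s - x"
      using n_eq t_pos four_t_le by (auto dest: T_bounds)
    moreover have "(n - s - x) mod n = (- s - x) mod n"
      by (metis add.commute add_diff_eq mod_add_self2 uminus_add_conv_diff diff_conv_add_uminus)
    ultimately show "(- s - x) mod n = n - s - x" by simp
  qed
  ultimately show ?thesis
    by (simp add: S_of_def residues_mod_def plus_minus_def image_Un image_image Un_assoc)
qed

lemma mem_S_iff:
  "z \<in> S \<longleftrightarrow> s + 2 * t \<le> z \<and> z \<le> 2 * s - 1 \<or> z - s \<in> T \<or> n - s - z \<in> T"
proof -
  have "z \<in> (\<lambda>x. s + x) ` T \<longleftrightarrow> z - s \<in> T"
    by (auto simp: image_iff) (metis add.commute diff_add_cancel)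
  moreover have "z \<in> (\<lambda>x. n - s - x) ` T \<longleftrightarrow> n - s - z \<in> T"
    by (auto simp: image_iff) (metis diff_diff_eq2 add_diff_cancel_left')
  ultimately show ?thesis
    unfolding S_eq_blocks by auto
qed

lemma S_bounds: "z \<in> S \<Longrightarrow> s \<le> z \<and> z \<le> 2 * s + 2 * t - 1"
  unfolding mem_S_iff using n_eq t_pos four_t_le by (auto dest: T_bounds)

lemma n_pos: "0 < n"
  using n_eq t_pos four_t_le by simp

lemma S_subset: "S \<subseteq> {0..<n}"
proof
  fix z assume "z \<in> S"
  then show "z \<in> {0..<n}" using S_bounds[of z] n_eq t_pos four_t_le by simp
qed

lemma carrier_eq: "carrier (integer_mod_group (nat n)) = {0..<n}"
  using n_pos by (simp add: carrier_integer_mod_group)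

lemma reflect_mem_S: "z \<in> S \<Longrightarrow> n - z \<in> S"
proof -
  have "n - s - (n - z) = z - s" "n - z - s = n - s - z" by auto
  moreover have "s + 2 * t \<le> z \<and> z \<le> 2 * s - 1 \<Longrightarrow> s + 2 * t \<le> n - z \<and> n - z \<le> 2 * s - 1"
    using n_eq by linarith
  ultimately show "z \<in> S \<Longrightarrow> n - z \<in> S" unfolding mem_S_iff by metis
qed

lemma low_mem_S_iff: "z \<le> s + 2 * t - 1 \<Longrightarrow> z \<in> S \<longleftrightarrow> z - s \<in> T"
  unfolding mem_S_iff using n_eq t_pos four_t_le by (auto dest: T_bounds)

lemma card_S: "int (card S) = s - 2 * t + 2 * int (card T)"
proof -
  have "card ((\<lambda>x. s + x) ` T) = card T" "card ((\<lambda>x. n - s - x) ` T) = card T"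
    by (auto intro!: card_image inj_onI)
  moreover have "{s + 2 * t..2 * s - 1} \<inter> (\<lambda>x. s + x) ` T = {}"
    by (auto dest: T_bounds)
  moreover have "({s + 2 * t..2 * s - 1} \<union> (\<lambda>x. s + x) ` T) \<inter> (\<lambda>x. n - s - x) ` T = {}"
    using n_eq t_pos four_t_le by (auto dest!: T_bounds)
  ultimately show ?thesis
    unfolding S_eq_blocks using finite_T t_pos four_t_le
    by (simp add: card_Un_disjoint)
qed

section \<open>Sum-freeness\<close>

text \<open>
  Every element of \<open>S\<close> is at least \<open>s\<close>, and \<open>n\<close> exceeds \<open>3 * s\<close> by only \<open>2 * t - 1\<close>; three
  elements with sum \<open>n\<close> therefore all lie in the block \<open>s + T\<close>.
\<close>

lemma three_sum_n_iff:
  "(\<exists>x\<in>S. \<exists>y\<in>S. \<exists>z\<in>S. x + y + z = n) \<longleftrightarrow> 2 * t - 1 \<in> T + T + T"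
proof
  assume "\<exists>x\<in>S. \<exists>y\<in>S. \<exists>z\<in>S. x + y + z = n"
  then obtain x y z where xyz: "x \<in> S" "y \<in> S" "z \<in> S" "x + y + z = n" by blast
  then have "x - s \<in> T" "y - s \<in> T" "z - s \<in> T"
    using S_bounds[of x] S_bounds[of y] S_bounds[of z] low_mem_S_iff n_eq by auto
  then have "(x - s) + (y - s) + (z - s) \<in> T + T + T"
    by (intro set_plus_intro)
  moreover have "(x - s) + (y - s) + (z - s) = 2 * t - 1" using xyz n_eq by simp
  ultimately show "2 * t - 1 \<in> T + T + T" by simp
next
  assume "2 * t - 1 \<in> T + T + T"
  then obtain a b c where abc: "a \<in> T" "b \<in> T" "c \<in> T" "2 * t - 1 = a + b + c"
    by (auto elim!: set_plus_elim)
  then have "s + a \<in> S" "s + b \<in> S" "s + c \<in> S" by (auto simp: mem_S_iff)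
  moreover have "(s + a) + (s + b) + (s + c) = n" using abc n_eq by simp
  ultimately show "\<exists>x\<in>S. \<exists>y\<in>S. \<exists>z\<in>S. x + y + z = n" by blast
qed

lemma sum_free_S_iff:
  "sum_free_in (integer_mod_group (nat n)) S \<longleftrightarrow> 2 * t - 1 \<notin> T + T + T"
proof -
  have "(\<exists>z\<in>S. \<exists>x\<in>S. \<exists>y\<in>S. x + y = z \<or> x + y = z + n) \<longleftrightarrow>
    (\<exists>x\<in>S. \<exists>y\<in>S. \<exists>z\<in>S. x + y + z = n)"
  proof
    assume "\<exists>z\<in>S. \<exists>x\<in>S. \<exists>y\<in>S. x + y = z \<or> x + y = z + n"
    then obtain x y z where xyz: "x \<in> S" "y \<in> S" "z \<in> S" "x + y = z \<or> x + y = z + n" by blast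
    from xyz(4) show "\<exists>x\<in>S. \<exists>y\<in>S. \<exists>z\<in>S. x + y + z = n"
    proof
      assume "x + y = z"
      then have "x + y + (n - z) = n" by simp
      then show ?thesis using xyz reflect_mem_S by blast
    next
      assume "x + y = z + n"
      then have "(n - x) + (n - y) + z = n" by simp
      then show ?thesis using xyz reflect_mem_S by blast
    qed
  next
    assume "\<exists>x\<in>S. \<exists>y\<in>S. \<exists>z\<in>S. x + y + z = n"
    then obtain x y z where xyz: "x \<in> S" "y \<in> S" "z \<in> S" "x + y + z = n" by blast
    then have "x + y = n - z" by simp
    then show "\<exists>z\<in>S. \<exists>x\<in>S. \<exists>y\<in>S. x + y = z \<or> x + y = z + n"
      using xyz reflect_mem_S by blast
  qed
  moreover have "sum_free_in (integer_mod_group (nat n)) S \<longleftrightarrow>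
    \<not> (\<exists>z\<in>S. \<exists>x\<in>S. \<exists>y\<in>S. x + y = z \<or> x + y = z + n)"
  proof -
    have "z \<in> S <#>\<^bsub>integer_mod_group (nat n)\<^esub> S \<longleftrightarrow>
        (\<exists>x\<in>S. \<exists>y\<in>S. x + y = z \<or> x + y = z + n)" if "z \<in> S" for z
      using mem_sumset_mod_iff[OF n_pos S_subset, of z] subsetD[OF S_subset that] by simp
    then show ?thesis unfolding sum_free_in_def by blast
  qed
  ultimately show ?thesis using three_sum_n_iff by blast
qed

section \<open>Completeness\<close>

abbreviation in_sumset :: "int \<Rightarrow> bool"
  where "in_sumset z \<equiv> \<exists>x\<in>S. \<exists>y\<in>S. x + y = z \<or> x + y = z + n"

lemma reflect_in_sumset:
  assumes "in_sumset z"
  shows "in_sumset (n - z)"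
proof -
  obtain x y where xy: "x \<in> S" "y \<in> S" "x + y = z \<or> x + y = z + n"
    using assms by blast
  then have "(n - x) + (n - y) = n - z \<or> (n - x) + (n - y) = n - z + n" by auto
  then show ?thesis using xy reflect_mem_S by blast
qed

text \<open>
  Since \<open>S = -S\<close>, differences of elements of \<open>S\<close> are sums. Differences within the middle
  interval give the residues below \<open>s - 2 * t\<close>. The middle
  interval minus \<open>s + m\<close> gives \<open>{2 * t - m..s - 1 - m}\<close>, and \<open>4 * t \<le> s\<close> leaves no gap between
  the two ranges.
\<close>

lemma small_in_sumset:
  assumes "m \<in> T" and "0 \<le> z" and "z \<le> s - 1 - m"
  shows "in_sumset z"
proof (cases "z \<le> s - 2 * t - 1")
  case True
  have "2 * s - 1 \<in> S" "s + 2 * t + z \<in> S"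
    unfolding mem_S_iff using True assms t_pos four_t_le by auto
  moreover have "(2 * s - 1) + (s + 2 * t + z) = z + n" using n_eq by simp
  ultimately show ?thesis by blast
next
  case False
  have "n - s - m \<in> S" "z + s + m \<in> S"
    unfolding mem_S_iff using False assms t_pos four_t_le T_bounds[of m] by auto
  moreover have "(n - s - m) + (z + s + m) = z + n" by simp
  ultimately show ?thesis by blast
qed

text \<open>
  Two elements of \<open>S\<close> whose sum represents a residue \<open>z\<close> in this range add up to \<open>z + n\<close>, as
  \<open>z < 2 * s\<close>. By minimality of \<open>m\<close> no element of \<open>S\<close> exceeds \<open>n - s - m\<close>, so each summand is
  at least \<open>z + s + m\<close>. This is at least \<open>2 * s\<close>, which leaves only the third block.
\<close>

lemma critical_in_sumset_iff:
  assumes "m \<in> T" and min: "\<And>x. x \<in> T \<Longrightarrow> m \<le> x"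
    and z: "s - m \<le> z" "z \<le> s + 2 * t - 1"
  shows "in_sumset z \<longleftrightarrow> s + 2 * t - 1 - z \<in> T + T"
proof
  assume "in_sumset z"
  then obtain x y where xy: "x \<in> S" "y \<in> S" "x + y = z \<or> x + y = z + n" by blast
  have m_bounds: "0 \<le> m" "m \<le> 2 * t - 1" using T_bounds \<open>m \<in> T\<close> by auto
  have sum: "x + y = z + n"
    using xy S_bounds[of x] S_bounds[of y] z t_pos four_t_le by auto
  have upper: "w \<le> n - s - m" if "w \<in> S" for w
    using that min[of "n - s - w"] T_bounds[of "w - s"] m_bounds n_eq t_pos four_t_le
    unfolding mem_S_iff by auto
  have "x \<ge> 2 * s" "y \<ge> 2 * s"
    using upper[OF xy(1)] upper[OF xy(2)] sum z by auto
  then have "n - s - x \<in> T" "n - s - y \<in> T"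
    using xy T_bounds[of "x - s"] T_bounds[of "y - s"] t_pos four_t_le
    unfolding mem_S_iff by auto
  then have "(n - s - x) + (n - s - y) \<in> T + T" by (intro set_plus_intro)
  moreover have "(n - s - x) + (n - s - y) = s + 2 * t - 1 - z" using sum n_eq by simp
  ultimately show "s + 2 * t - 1 - z \<in> T + T" by simp
next
  assume "s + 2 * t - 1 - z \<in> T + T"
  then obtain a b where ab: "a \<in> T" "b \<in> T" "s + 2 * t - 1 - z = a + b"
    by (auto elim!: set_plus_elim)
  then have "n - s - a \<in> S" "n - s - b \<in> S" by (auto simp: mem_S_iff)
  moreover have "(n - s - a) + (n - s - b) = z + n" using ab n_eq by simp
  ultimately show "in_sumset z" by blast
qed

lemma complete_S_iff:
  assumes "T \<noteq> {}"
  shows "complete_in (integer_mod_group (nat n)) S \<longleftrightarrow>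
    {0..2 * t - 1 + Min T} - (\<lambda>x. 2 * t - 1 - x) ` T \<subseteq> T + T"
proof -
  define m where "m = Min T"
  have m: "m \<in> T" "\<And>x. x \<in> T \<Longrightarrow> m \<le> x"
    unfolding m_def using finite_T assms by auto
  have m_bounds: "0 \<le> m" "m \<le> 2 * t - 1" using T_bounds m by auto
  have "complete_in (integer_mod_group (nat n)) S \<longleftrightarrow> (\<forall>z\<in>{0..<n} - S. in_sumset z)"
    unfolding complete_in_def carrier_eq
    using mem_sumset_mod_iff[OF n_pos S_subset] by auto
  also have "\<dots> \<longleftrightarrow> (\<forall>z\<in>{s - m..s + 2 * t - 1} - S. in_sumset z)"
  proof
    assume "\<forall>z\<in>{0..<n} - S. in_sumset z"
    then show "\<forall>z\<in>{s - m..s + 2 * t - 1} - S. in_sumset z"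
      using m_bounds n_eq t_pos four_t_le by auto
  next
    assume critical: "\<forall>z\<in>{s - m..s + 2 * t - 1} - S. in_sumset z"
    have lower: "in_sumset z" if "z \<notin> S" "0 \<le> z" "z \<le> 2 * s - 1" for z
    proof -
      have "z \<le> s + 2 * t - 1" using that unfolding mem_S_iff by auto
      then show ?thesis
        using critical small_in_sumset[OF m(1)] that by (cases "z \<le> s - 1 - m") auto
    qed
    show "\<forall>z\<in>{0..<n} - S. in_sumset z"
    proof
      fix z assume z: "z \<in> {0..<n} - S"
      show "in_sumset z"
      proof (cases "z \<le> 2 * s - 1")
        case True
        then show ?thesis using lower z by auto
      next
        case False
        have "n - z \<notin> S" using z reflect_mem_S[of "n - z"] by auto
        then have "in_sumset (n - z)"
          using lower[of "n - z"] False z n_eq t_pos four_t_le by auto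
        then show ?thesis using reflect_in_sumset[of "n - z"] by simp
      qed
    qed
  qed
  also have "\<dots> \<longleftrightarrow> (\<forall>z\<in>{s - m..s + 2 * t - 1}. z - s \<notin> T \<longrightarrow> s + 2 * t - 1 - z \<in> T + T)"
    using critical_in_sumset_iff[OF m] low_mem_S_iff by auto
  also have "\<dots> \<longleftrightarrow> (\<forall>w\<in>{0..2 * t - 1 + m}. 2 * t - 1 - w \<notin> T \<longrightarrow> w \<in> T + T)"
  proof -
    have "{s - m..s + 2 * t - 1} = (\<lambda>w. s + 2 * t - 1 - w) ` {0..2 * t - 1 + m}"
      by (auto simp: image_iff intro!: bexI[of _ "s + 2 * t - 1 - x" for x])
    then show ?thesis by (simp add: algebra_simps)
  qed
  also have "\<dots> \<longleftrightarrow> {0..2 * t - 1 + m} - (\<lambda>x. 2 * t - 1 - x) ` T \<subseteq> T + T"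
  proof -
    have "w \<in> (\<lambda>x. 2 * t - 1 - x) ` T \<longleftrightarrow> 2 * t - 1 - w \<in> T" for w
      by (auto simp: image_iff) (metis diff_diff_eq2 add_diff_cancel_left')
    then show ?thesis by blast
  qed
  finally show ?thesis unfolding m_def .
qed

end

section \<open>Special sets and complete sum-free sets\<close>

theorem theorem3p7:
  fixes n s t :: int and T :: "int set"
  assumes "real_of_int t = (real_of_int n - 3 * real_of_int s + 1) / 2"
    and "t > 0"
    and "real_of_int n \<le> 7 * real_of_int s / 2 - 1"
    and "T \<subseteq> {0 .. 2*t - 1}"
  shows "special t T \<longleftrightarrow>
    S_of n s T \<subseteq> carrier (integer_mod_group (nat n)) \<and>
    complete_in (integer_mod_group (nat n)) (S_of n s T) \<and>
    sum_free_in (integer_mod_group (nat n)) (S_of n s T) \<and>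
    int (card (S_of n s T)) = s"
proof -
  have n_eq: "n = 3 * s + 2 * t - 1"
  proof -
    have "real_of_int (2 * t) = real_of_int (n - 3 * s + 1)" using assms(1) by simp
    then show ?thesis by (simp only: of_int_eq_iff)
  qed
  have "4 * t \<le> s"
  proof -
    have "real_of_int (2 * n) \<le> real_of_int (7 * s - 2)" using assms(3) by simp
    then show ?thesis using n_eq unfolding of_int_le_iff by linarith
  qed
  then interpret block_parameters n s t T
    using n_eq assms by unfold_locales auto
  have card_iff: "int (card S) = s \<longleftrightarrow> int (card T) = t"
    using card_S by auto
  \<comment> \<open>\<open>Min T\<close> has a meaning only for nonempty \<open>T\<close>; both sides guarantee this by their
    cardinality conditions.\<close>
  have nonempty: "T \<noteq> {}" if "int (card T) = t"
    using that t_pos by auto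
  show ?thesis
    unfolding card_iff sum_free_S_iff
    using complete_S_iff[OF nonempty] S_subset carrier_eq T_subset t_pos
    by (auto simp: special_def)
qed

end
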